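(* Let $n>k\ge 1$ be integers. (i) If $\nu(k)<\nu(n)$, or if $\nu(k)=\nu(n)$ and $2^{\nu(n-k)}\in[k]$, then \[ \lim_{h\to\infty}\nu(S(2^hn,2^hk)) = \sigma(k)-\sigma(n)+\nu\binom{n+n-k}{n}, \] and $\nu(S(2^hn,2^hk))$ equals this limit for every integer $h\ge 0$ with $2^{h-1+\nu(n-k)} \ge \nu\binom{n+n-k}{n}$. (ii) If $\nu(n)<\nu(k)$, or if $\nu(n)=\nu(k)$ and $2^{\nu(n-k)}\in[n]$, then \[ \lim_{h\to\infty}\nu(S(2^hn,2^hk)) = \sigma(k-1)-\sigma(n-1)+\nu\binom{n-1+n-k}{n-1}. \] Furthermore, if $\nu(n)<\nu(k)$, then $\nu(S(2^hn,2^hk))$ equals this limit for every integer $h\ge0$ with $2^{h-1+\nu(n)}\ge \nu\binom{n-1+n-k}{n-1}$; while if $\nu(n)=\nu(k)$ and $2^{\nu(n-k)}\in[n]$, then $\nu(S(2^hn,2^hk))$ equals this limit for every integer $h\ge 0$ with $2^{h-1+\nu(n)} > \nu\binom{n-1+n-k}{n-1}$.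
   Context: $S(n,k)$ denotes the Stirling number of the second kind and $\nu$ the $2$-adic valuation. For a nonnegative integer $m$, $\sigma(m)$ is the sum of its base-$2$ digits and $[m]$ is the set of powers of $2$ occurring in its base-$2$ expansion. *)

theory Defs
  imports Complex_Main "HOL-Combinatorics.Stirling" "HOL-Computational_Algebra.Primes"
begin

abbreviation nu2 :: "nat \<Rightarrow> nat" where
  "nu2 m \<equiv> multiplicity 2 m"

text \<open>The \<open>i\<close>-th binary digit of \<open>m\<close> is \<open>m div 2 ^ i mod 2\<close>; the digits with
  \<open>i \<ge> m\<close> all vanish because \<open>m < 2 ^ m\<close>.\<close>

definition binary_digit_sum :: "nat \<Rightarrow> nat" where
  "binary_digit_sum m = (\<Sum>i\<le>m. m div 2 ^ i mod 2)"

definition binary_powers :: "nat \<Rightarrow> nat set" where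
  "binary_powers m = {2 ^ i | i. m div 2 ^ i mod 2 = 1}"

end

(* Put G = log (1 + 2 u) / (2 u) and m = n - k.  Lagrange inversion of
   (exp t - 1)^k / k! gives, with D = 1 / (1 + 2 u),
     2^m k! S(n,k) / n! = [u^m] G^(-n-1) D = (k/n) [u^m] G^(-n).
   Write G = 1 - u Q; the r-th coefficient of Q^d (or Q^d D) is divisible by 2^ceil(r/2).
   Hence [u^m] G^(-N-1) is C(N+m,m) plus multiples of C(N+d,d) 2^ceil((m-d)/2) with d < m.
   Once m - d > 2 nu C(N+m,m) the power of 2 wins; for smaller m - d, counting binary carries
   shows that C(N+d,d) is at least as divisible by 2 as C(N+m,m).  The digit hypotheses on n
   or k decide which of N = n and N = n - 1 makes the carry count work.  Finally, the
   valuations of C(n+m,m) and C(n-1+m,m) do not change when n and k are multiplied by 2^h. *)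

theory Submission
  imports Defs "HOL-Computational_Algebra.Formal_Power_Series"
begin

section \<open>Binary digit sums and the 2-adic valuation of factorials and binomials\<close>

lemma binary_digit_sum_le:
  assumes "m \<le> N"
  shows "binary_digit_sum m = (\<Sum>i\<le>N. m div 2 ^ i mod 2)"
proof -
  have "m div 2 ^ i mod 2 = 0" if "i > m" for i
  proof -
    have "m < 2 ^ i" using that less_exp[of i] by linarith
    then show ?thesis by simp
  qed
  then show ?thesis
    unfolding binary_digit_sum_def using assms
    by (intro sum.mono_neutral_left) auto
qed

lemma binary_digit_sum_0 [simp]: "binary_digit_sum 0 = 0"
  by (simp add: binary_digit_sum_def)

lemma binary_digit_sum_rec: "binary_digit_sum m = m mod 2 + binary_digit_sum (m div 2)"
proof -
  have "binary_digit_sum m = (\<Sum>i\<le>Suc m. m div 2 ^ i mod 2)"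
    by (rule binary_digit_sum_le) simp
  also have "\<dots> = m mod 2 + (\<Sum>i\<le>m. m div 2 div 2 ^ i mod 2)"
    by (subst sum.atMost_Suc_shift) (simp add: div_mult2_eq)
  also have "\<dots> = m mod 2 + binary_digit_sum (m div 2)"
    using binary_digit_sum_le[of "m div 2" m] by simp
  finally show ?thesis .
qed

lemma binary_digit_sum_double: "binary_digit_sum (2 * m) = binary_digit_sum m"
  and binary_digit_sum_Suc_double: "binary_digit_sum (Suc (2 * m)) = Suc (binary_digit_sum m)"
  using binary_digit_sum_rec[of "2 * m"] binary_digit_sum_rec[of "Suc (2 * m)"] by simp_all

lemma binary_digit_sum_pow2_mult: "binary_digit_sum (2 ^ h * m) = binary_digit_sum m"
  by (induction h) (simp_all add: mult.assoc binary_digit_sum_double)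

lemma binary_digit_sum_pow2 [simp]: "binary_digit_sum (2 ^ h) = 1"
  using binary_digit_sum_pow2_mult[of h 1] binary_digit_sum_Suc_double[of 0] by simp

text \<open>The two summands occupy disjoint digit positions, so no carry arises. The induction
  strips the lowest digit of \<open>p\<close>.\<close>

lemma binary_digit_sum_add_block:
  "p < 2 ^ j \<Longrightarrow> binary_digit_sum (2 ^ j * a + p) = binary_digit_sum a + binary_digit_sum p"
proof (induction j arbitrary: p)
  case (Suc j)
  have "binary_digit_sum (2 ^ Suc j * a + p) = p mod 2 + binary_digit_sum (2 ^ j * a + p div 2)"
    by (subst binary_digit_sum_rec) (simp add: mult.assoc)
  also have "\<dots> = binary_digit_sum a + binary_digit_sum p"
    using Suc.IH[of "p div 2"] Suc.prems binary_digit_sum_rec[of p] by simp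
  finally show ?case .
qed simp

lemma nu2_double: "m > 0 \<Longrightarrow> nu2 (2 * m) = Suc (nu2 m)"
  by (subst multiplicity_times_same) simp_all

text \<open>Adding 1 turns the \<open>nu2 (Suc m)\<close> trailing ones into zeros and the next zero
  into a one. Besides driving Legendre's formula, this later relates digit sums at
  \<open>k - 1\<close> and \<open>n - 1\<close> to those at \<open>k\<close> and
  \<open>n\<close>.\<close>

lemma binary_digit_sum_Suc: "binary_digit_sum (Suc m) + nu2 (Suc m) = Suc (binary_digit_sum m)"
proof (induction m rule: less_induct)
  case (less m)
  show ?case
  proof (cases "even m")
    case True
    then obtain a where m: "m = 2 * a" by blast
    have "nu2 (Suc m) = 0" using True by (intro not_dvd_imp_multiplicity_0) simp
    then show ?thesis
      by (simp add: m binary_digit_sum_double binary_digit_sum_Suc_double)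
  next
    case False
    then obtain a where m: "m = Suc (2 * a)" by (auto elim: oddE)
    have "Suc m = 2 * Suc a" by (simp add: m)
    then show ?thesis
      using less.IH[of a] nu2_double[of "Suc a"]
      by (simp only: m binary_digit_sum_double binary_digit_sum_Suc_double) simp
  qed
qed

lemma nu2_mult: "a > 0 \<Longrightarrow> b > 0 \<Longrightarrow> nu2 (a * b) = nu2 a + nu2 b"
  by (rule prime_elem_multiplicity_mult_distrib) auto

lemma nu2_pow2_mult: "a > 0 \<Longrightarrow> nu2 (2 ^ h * a) = h + nu2 a"
  by (simp add: nu2_mult)

text \<open>Legendre's formula at 2, kept additive to avoid truncated subtraction.\<close>

lemma legendre_2: "nu2 (fact m) + binary_digit_sum m = m"
proof (induction m)
  case (Suc m)
  then show ?case
    using binary_digit_sum_Suc[of m] nu2_mult[of "Suc m" "fact m"]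
    by (simp add: fact_Suc del: mult_Suc)
qed simp

text \<open>Kummer's theorem at 2: the valuation counts the carries in \<open>a + b\<close>, each of
  which lowers the digit sum by one. It follows from Legendre's formula for three
  factorials.\<close>

lemma nu2_binomial:
  "nu2 (a + b choose b) + binary_digit_sum (a + b) = binary_digit_sum a + binary_digit_sum b"
proof -
  have "fact b * fact a * (a + b choose b) = (fact (a + b) :: nat)"
    using binomial_fact_lemma[of b "a + b"] by simp
  then have "nu2 (fact b * fact a * (a + b choose b)) = nu2 (fact (a + b))" by simp
  then have "nu2 (fact b) + nu2 (fact a) + nu2 (a + b choose b) = nu2 (fact (a + b))"
    by (simp add: nu2_mult)
  then show ?thesis
    using legendre_2[of a] legendre_2[of b] legendre_2[of "a + b"] by linarith
qed

section \<open>Comparing the carries in \<open>n + m\<close> and \<open>n + d\<close> for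
  \<open>d\<close> slightly below \<open>m\<close>\<close>

lemma nu2_decomp:
  assumes "(m::nat) > 0"
  obtains B where "m = 2 ^ nu2 m * (2 * B + 1)"
proof -
  obtain c where c: "m = 2 ^ nu2 m * c" "\<not> 2 dvd c"
    using multiplicity_decompose'[of m 2] assms by auto
  then obtain B where "c = 2 * B + 1" by (elim oddE)
  with c that show thesis by metis
qed

text \<open>Adding \<open>m\<close> to \<open>n\<close> produces no carry up to position
  \<open>nu2 m\<close>, since \<open>m\<close> is zero below that position and \<open>n\<close> is
  zero at it. So \<open>n + m\<close> has just the carries of the high parts \<open>A + B\<close>,
  while \<open>n + d\<close> has these and those of \<open>p + q\<close>.\<close>

lemma nu2_binomial_le_digit_0:
  assumes m: "m > 0" and bit: "n div 2 ^ nu2 m mod 2 = 0"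
    and d: "d < m" "m - d \<le> 2 ^ nu2 m"
  shows "nu2 (n + m choose m) \<le> nu2 (n + d choose d)"
proof -
  define x where "x = nu2 m"
  define p where "p = n mod 2 ^ x"
  \<comment> \<open>Lowering \<open>m\<close> to \<open>d\<close> clears the lowest one of
    \<open>m\<close> and leaves \<open>q\<close> below it; the bound on \<open>m - d\<close>
    prevents a borrow from \<open>B\<close>.\<close>
  define q where "q = 2 ^ x - (m - d)"
  obtain B where B: "m = 2 ^ x * (2 * B + 1)" using nu2_decomp[OF m] x_def by auto
  obtain A where A: "n div 2 ^ x = 2 * A" using bit x_def by fastforce
  have n: "n = 2 ^ Suc x * A + p"
    unfolding p_def using div_mult_mod_eq[of n "2 ^ x"] A by (simp add: mult.commute)
  have p: "p < 2 ^ x" by (simp add: p_def)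
  have q: "q < 2 ^ x" unfolding q_def using d by (intro diff_less) auto
  have dq: "d = 2 ^ Suc x * B + q"
    using d B unfolding q_def x_def[symmetric] by (simp add: algebra_simps)
  have mB: "m = 2 ^ Suc x * B + 2 ^ x" using B by (simp add: algebra_simps)
  have "n + m = 2 ^ Suc x * (A + B) + (2 ^ x * 1 + p)" "n + d = 2 ^ Suc x * (A + B) + (p + q)"
    unfolding n dq mB by (simp_all add: algebra_simps)
  then have
    "binary_digit_sum (n + m) = binary_digit_sum (A + B) + (1 + binary_digit_sum p)"
    "binary_digit_sum (n + d) = binary_digit_sum (A + B) + binary_digit_sum (p + q)"
    using p q binary_digit_sum_add_block[of "2 ^ x * 1 + p" "Suc x" "A + B"]
      binary_digit_sum_add_block[of "p + q" "Suc x" "A + B"]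
      binary_digit_sum_add_block[of p x 1] binary_digit_sum_pow2[of 0] by simp_all
  moreover have "binary_digit_sum n = binary_digit_sum A + binary_digit_sum p"
    "binary_digit_sum m = binary_digit_sum B + 1"
    "binary_digit_sum d = binary_digit_sum B + binary_digit_sum q"
    unfolding n mB dq using p q by (subst binary_digit_sum_add_block; simp)+
  ultimately show ?thesis
    using nu2_binomial[of n m] nu2_binomial[of n d] nu2_binomial[of p q] by linarith
qed

text \<open>Here \<open>n + m\<close> carries out of position \<open>nu2 m\<close>. The bound on
  \<open>m - d\<close> forces \<open>p + q\<close> to overflow into that position too, and the digit
  1 of \<open>n\<close> there passes the carry on. Both sums thus have high part
  \<open>A + B + 1\<close>, and \<open>n + d\<close> again has at least as many carries.\<close>

lemma nu2_binomial_le_digit_1: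
  assumes m: "m > 0" and bit: "n div 2 ^ nu2 m mod 2 = 1"
    and d: "d < m" "m - d \<le> n mod 2 ^ nu2 m"
  shows "nu2 (n + m choose m) \<le> nu2 (n + d choose d)"
proof -
  define x where "x = nu2 m"
  define p where "p = n mod 2 ^ x"
  define q where "q = 2 ^ x - (m - d)"
  obtain B where B: "m = 2 ^ x * (2 * B + 1)" using nu2_decomp[OF m] x_def by auto
  obtain A where A: "n div 2 ^ x = 2 * A + 1"
    using bit x_def by (metis div_mult_mod_eq mult.commute)
  have n: "n = 2 ^ Suc x * A + (2 ^ x * 1 + p)"
    unfolding p_def using div_mult_mod_eq[of n "2 ^ x"] A by (simp add: algebra_simps)
  have p: "p < 2 ^ x" and r: "m - d \<le> p" "m - d < 2 ^ x"
    using d unfolding p_def x_def[symmetric] by (auto intro: le_less_trans)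
  then have q: "q < 2 ^ x" and pq: "2 ^ x \<le> p + q"
    unfolding q_def using d by auto
  define s where "s = p + q - 2 ^ x"
  have s: "p + q = 2 ^ x * 1 + s" "s < 2 ^ x" using pq p q by (auto simp: s_def)
  have dq: "d = 2 ^ Suc x * B + q"
    using d r B unfolding q_def x_def[symmetric] by (simp add: algebra_simps)
  have mB: "m = 2 ^ Suc x * B + 2 ^ x" using B by (simp add: algebra_simps)
  have "n + m = 2 ^ Suc x * (A + B + 1) + p"
    unfolding n mB by (simp add: algebra_simps)
  moreover have "n + d = 2 ^ Suc x * (A + B + 1) + s"
    unfolding n dq using s by (simp add: algebra_simps)
  ultimately have
    "binary_digit_sum (n + m) = binary_digit_sum (A + B + 1) + binary_digit_sum p"
    "binary_digit_sum (n + d) = binary_digit_sum (A + B + 1) + binary_digit_sum s"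
    using p s binary_digit_sum_add_block[of p "Suc x" "A + B + 1"]
      binary_digit_sum_add_block[of s "Suc x" "A + B + 1"] by simp_all
  moreover have "binary_digit_sum n = binary_digit_sum A + (1 + binary_digit_sum p)"
    using p binary_digit_sum_add_block[of "2 ^ x * 1 + p" "Suc x" A]
      binary_digit_sum_add_block[of p x 1] binary_digit_sum_pow2[of 0] n by simp
  moreover have "binary_digit_sum (p + q) = 1 + binary_digit_sum s"
    using s binary_digit_sum_add_block[of s x 1] binary_digit_sum_pow2[of 0] by simp
  moreover have "binary_digit_sum m = binary_digit_sum B + 1"
    "binary_digit_sum d = binary_digit_sum B + binary_digit_sum q"
    unfolding mB dq using q by (subst binary_digit_sum_add_block; simp)+
  ultimately show ?thesis
    using nu2_binomial[of n m] nu2_binomial[of n d] nu2_binomial[of p q] by linarith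
qed


section \<open>Divisibility by powers of 2 among rationals with odd denominator\<close>

text \<open>This is divisibility by \<open>2 ^ e\<close> in the localization of the integers at 2,
  with denominators cleared. Unlike a valuation, it needs no special value at 0.\<close>

definition dvd2 :: "nat \<Rightarrow> rat \<Rightarrow> bool" where
  "dvd2 e q \<longleftrightarrow> (\<exists>a c. odd c \<and> q * of_int c = 2 ^ e * of_int a)"

lemma dvd2_0 [simp]: "dvd2 e 0"
  unfolding dvd2_def by (rule exI[of _ 0], rule exI[of _ 1]) simp

lemma dvd2_mono:
  assumes "dvd2 e q" "e' \<le> e"
  shows "dvd2 e' q"
proof -
  obtain a c where "odd c" "q * of_int c = 2 ^ e * of_int a" using assms(1) dvd2_def by auto
  moreover have "(2::rat) ^ e * of_int a = 2 ^ e' * of_int (2 ^ (e - e') * a)"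
    using assms(2) by (simp flip: power_add)
  ultimately show ?thesis unfolding dvd2_def by metis
qed

lemma dvd2_add:
  assumes "dvd2 e p" "dvd2 e q"
  shows "dvd2 e (p + q)"
proof -
  obtain a c a' c' where *: "odd c" "p * of_int c = 2 ^ e * of_int a"
      "odd c'" "q * of_int c' = 2 ^ e * of_int a'"
    using assms dvd2_def by auto
  have "(p + q) * of_int (c * c') = (p * of_int c) * of_int c' + (q * of_int c') * of_int c"
    by (simp add: algebra_simps)
  also have "\<dots> = 2 ^ e * of_int (a * c' + a' * c)"
    unfolding * by (simp add: algebra_simps)
  finally show ?thesis unfolding dvd2_def using * by (metis even_mult_iff)
qed

lemma dvd2_sum: "(\<And>x. x \<in> A \<Longrightarrow> dvd2 e (f x)) \<Longrightarrow> dvd2 e (sum f A)"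
  by (induction A rule: infinite_finite_induct) (auto intro: dvd2_add)

lemma dvd2_mult:
  assumes "dvd2 e p" "dvd2 e' q"
  shows "dvd2 (e + e') (p * q)"
proof -
  obtain a c a' c' where *: "odd c" "p * of_int c = 2 ^ e * of_int a"
      "odd c'" "q * of_int c' = 2 ^ e' * of_int a'"
    using assms dvd2_def by auto
  have "(p * q) * of_int (c * c') = (p * of_int c) * (q * of_int c')"
    by (simp add: algebra_simps)
  also have "\<dots> = 2 ^ (e + e') * of_int (a * a')"
    unfolding * by (simp add: algebra_simps power_add)
  finally show ?thesis unfolding dvd2_def using * by (metis even_mult_iff)
qed

lemma dvd2_of_int: "2 ^ e dvd a \<Longrightarrow> dvd2 e (of_int a)"
  unfolding dvd2_def by (elim dvdE, intro exI[of _ 1] exI) (auto intro: exI)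

lemma dvd2_of_nat:
  assumes "2 ^ e dvd a"
  shows "dvd2 e (of_nat a)"
proof -
  have "int (2 ^ e) dvd int a" using assms by (subst of_nat_dvd_iff)
  then show ?thesis using dvd2_of_int[of e "int a"] by simp
qed

text \<open>The slope \<open>1/2\<close> is dictated by the cubic term of \<open>log (1 + 2 u)\<close>.\<close>

definition half_slope :: "rat fps \<Rightarrow> bool" where
  "half_slope f \<longleftrightarrow> (\<forall>r. dvd2 ((r + 1) div 2) (fps_nth f r))"

text \<open>Ceilings of halves are subadditive, so every term of the Cauchy product obeys the
  bound.\<close>

lemma half_slope_mult:
  assumes "half_slope f" "half_slope g"
  shows "half_slope (f * g)"
  unfolding half_slope_def fps_mult_nth
proof (intro allI dvd2_sum)
  fix r i :: nat
  assume i: "i \<in> {0..r}"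
  have "dvd2 ((i + 1) div 2 + (r - i + 1) div 2) (fps_nth f i * fps_nth g (r - i))"
    using assms by (intro dvd2_mult) (auto simp: half_slope_def)
  moreover have "(r + 1) div 2 \<le> (i + 1) div 2 + (r - i + 1) div 2"
    using i by auto
  ultimately show "dvd2 ((r + 1) div 2) (fps_nth f i * fps_nth g (r - i))"
    by (rule dvd2_mono)
qed

lemma half_slope_power_mult: "half_slope f \<Longrightarrow> half_slope g \<Longrightarrow> half_slope (f ^ d * g)"
  by (induction d) (auto simp: mult.assoc intro: half_slope_mult)

lemma half_slope_1 [simp]: "half_slope 1"
  by (auto simp: half_slope_def fps_one_nth intro: dvd2_of_int[of 0 1, simplified])

section \<open>Power series of the logarithm, and Stirling numbers as coefficients\<close>

text \<open>\<open>log_ser\<close> is \<open>log (1 + 2 u) / (2 u)\<close>.\<close>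

definition log_ser :: "rat fps" where
  "log_ser = Abs_fps (\<lambda>i. (-2) ^ i / of_nat (Suc i))"

definition inv_log_ser :: "rat fps" where
  "inv_log_ser = inverse log_ser"

text \<open>The series D = 1 / (1 + 2 u).\<close>

definition geo_ser :: "rat fps" where
  "geo_ser = Abs_fps (\<lambda>i. (-2) ^ i)"

text \<open>The series Q in G = 1 - u Q; its constant term is 1.\<close>

definition log_tail :: "rat fps" where
  "log_tail = Abs_fps (\<lambda>i. - ((-2) ^ Suc i / of_nat (i + 2)))"

lemma inv_log_ser_mult: "inv_log_ser * log_ser = 1"
  unfolding inv_log_ser_def by (rule inverse_mult_eq_1) (simp add: log_ser_def)

lemma geo_ser_mult: "geo_ser * (1 + 2 * fps_X) = 1"
proof (rule fps_ext)
  fix i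
  have "geo_ser * (1 + 2 * fps_X) = geo_ser + 2 * (fps_X * geo_ser)"
    by (simp add: algebra_simps)
  also have "fps_nth \<dots> i = fps_nth 1 i"
    by (cases i) (simp_all add: geo_ser_def numeral_fps_const)
  finally show "fps_nth (geo_ser * (1 + 2 * fps_X)) i = fps_nth 1 i" .
qed

text \<open>Both sides are the derivative of u G = log (1 + 2 u) / 2.\<close>

lemma geo_ser_eq: "geo_ser = log_ser + fps_X * fps_deriv log_ser"
proof (rule fps_ext)
  fix i
  have "fps_nth (log_ser + fps_X * fps_deriv log_ser) i = of_nat (Suc i) * fps_nth log_ser i"
    by (simp add: fps_mult_fps_X_deriv_shift distrib_right)
  then show "fps_nth geo_ser i = fps_nth (log_ser + fps_X * fps_deriv log_ser) i"
    by (simp add: geo_ser_def log_ser_def del: of_nat_Suc)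
qed

lemma log_ser_eq: "log_ser = 1 - fps_X * log_tail"
  by (rule fps_ext, rename_tac i, case_tac i)
     (simp_all add: log_ser_def log_tail_def)

text \<open>A rearrangement of \<open>inv_log_ser * (1 - fps_X * log_tail) = 1\<close> that lets one
  factor be peeled off a power of \<open>inv_log_ser\<close>.\<close>

lemma inv_log_ser_eq: "inv_log_ser = 1 + fps_X * (inv_log_ser * log_tail)"
  using inv_log_ser_mult unfolding log_ser_eq by (simp add: algebra_simps)

text \<open>By \<open>geo_ser_eq\<close>, u G' = D - G. The resulting differential equation
  expresses derivatives of powers of \<open>inv_log_ser\<close> without any derivative.\<close>

lemma X_deriv_inv_log_ser:
  "fps_X * fps_deriv inv_log_ser = inv_log_ser - geo_ser * inv_log_ser ^ 2"
proof -
  have "fps_deriv inv_log_ser = - fps_deriv log_ser * inv_log_ser ^ 2"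
    unfolding inv_log_ser_def by (rule fps_inverse_deriv) (simp add: log_ser_def)
  then have "fps_X * fps_deriv inv_log_ser = - (fps_X * fps_deriv log_ser) * inv_log_ser ^ 2"
    by (simp add: algebra_simps)
  also have "\<dots> = (log_ser - geo_ser) * inv_log_ser ^ 2"
    by (simp add: geo_ser_eq)
  also have "\<dots> = inv_log_ser - geo_ser * inv_log_ser ^ 2"
  proof -
    have "(log_ser - geo_ser) * inv_log_ser ^ 2
        = (inv_log_ser * log_ser) * inv_log_ser - geo_ser * inv_log_ser ^ 2"
      by (simp add: algebra_simps power2_eq_square)
    then show ?thesis by (simp add: inv_log_ser_mult)
  qed
  finally show ?thesis .
qed

text \<open>This is the coefficient of \<open>u\<^sup>j\<close> in \<open>u f' = n f - n f D / G\<close> with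
  \<open>f = G\<^sup>-\<^sup>n\<close> and \<open>n = k + j\<close>.\<close>

lemma inv_log_ser_power_nth:
  "of_nat k * fps_nth (inv_log_ser ^ (k + j)) j
     = of_nat (k + j) * fps_nth (inv_log_ser ^ Suc (k + j) * geo_ser) j"
proof (cases "k + j")
  case (Suc n)
  define V where "V = inv_log_ser"
  have "fps_X * fps_deriv (V ^ Suc n)
      = of_nat (Suc n) * (V ^ n * (fps_X * fps_deriv V))"
    by (simp only: fps_deriv_power' diff_Suc_1) (simp add: algebra_simps)
  also have "\<dots> = of_nat (Suc n) * (V ^ Suc n - V ^ Suc (Suc n) * geo_ser)"
    unfolding X_deriv_inv_log_ser V_def by (simp add: algebra_simps power2_eq_square)
  finally have "fps_nth (fps_X * fps_deriv (V ^ Suc n)) j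
      = fps_nth (of_nat (Suc n) * (V ^ Suc n - V ^ Suc (Suc n) * geo_ser)) j" by simp
  then have "of_nat j * fps_nth (V ^ Suc n) j
      = of_nat (Suc n) * (fps_nth (V ^ Suc n) j - fps_nth (V ^ Suc (Suc n) * geo_ser) j)"
    by (simp only: fps_mult_fps_X_deriv_shift fps_nth_Abs_fps fps_mult_of_nat_nth fps_sub_nth)
  moreover have "(of_nat (Suc n) :: rat) = of_nat k + of_nat j"
    by (simp flip: Suc)
  ultimately show ?thesis
    unfolding Suc V_def[symmetric] by (simp only: algebra_simps)
qed auto

text \<open>In place of Lagrange inversion, induction on \<open>k + j\<close> checks that the
  coefficients satisfy the Stirling recurrence: in (1 + 2 u) \<open>R n\<close>, the summand 1
  yields \<open>Stirling n k'\<close> and the summand 2 u yields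
  \<open>Stirling n k\<close>.\<close>

lemma Stirling_eq_nth:
  "of_nat (Stirling (k + j) k) * fact k * 2 ^ j
     = fact (k + j) * fps_nth (inv_log_ser ^ Suc (k + j) * geo_ser) j"
proof (induction "k + j" arbitrary: k j)
  case 0
  then show ?case by (simp add: inv_log_ser_def log_ser_def geo_ser_def)
next
  case (Suc n)
  define R where "R = (\<lambda>n. inv_log_ser ^ Suc n * geo_ser)"
  have rec: "inv_log_ser ^ Suc n = R n + 2 * (fps_X * R n)"
  proof -
    have "inv_log_ser ^ Suc n = inv_log_ser ^ Suc n * (geo_ser * (1 + 2 * fps_X))"
      by (simp add: geo_ser_mult)
    then show ?thesis by (simp add: R_def algebra_simps)
  qed
  have step: "of_nat (Suc n) * fps_nth (R (Suc n)) j = of_nat k * fps_nth (R n + 2 * (fps_X * R n)) j"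
    using inv_log_ser_power_nth[of k j] R_def
    unfolding Suc.hyps(2)[symmetric] rec by metis
  show ?case
  proof (cases k)
    case 0
    with step have "fps_nth (R (Suc n)) j = 0" by simp
    then show ?thesis using 0 Suc.hyps(2) by (cases j) (simp_all add: R_def)
  next
    case k: (Suc k')
    have n: "n = k' + j" using Suc.hyps(2) k by simp
    have IH1: "of_nat (Stirling n k') * fact k' * 2 ^ j = fact n * fps_nth (R n) j"
      using Suc.hyps(1)[OF n] n R_def by simp
    have nth2: "fps_nth (2 * f) i = 2 * fps_nth f i" for f :: "rat fps" and i
      by (simp add: numeral_fps_const)
    have IH2: "of_nat (Stirling n k) * fact k * 2 ^ j = fact n * fps_nth (2 * (fps_X * R n)) j"
    proof (cases j)
      \<comment> \<open>Here \<open>k = Suc n\<close>, so the Stirling number vanishes, as does the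
        constant term of \<open>fps_X * R n\<close>.\<close>
      case 0
      then show ?thesis using n k by (simp add: nth2)
    next
      case (Suc j')
      have "n = k + j'" using n k Suc by simp
      with Suc.hyps(1)[OF this] Suc show ?thesis by (simp add: nth2 R_def)
    qed
    have "of_nat (Stirling (Suc n) k) * fact k * 2 ^ j
        = of_nat k * (of_nat (Stirling n k) * fact k * 2 ^ j)
          + of_nat k * (of_nat (Stirling n k') * fact k' * (2::rat) ^ j)"
      by (simp add: k algebra_simps)
    also have "\<dots> = fact n * (of_nat k * fps_nth (R n + 2 * (fps_X * R n)) j)"
      unfolding IH1 IH2 by (simp add: algebra_simps)
    also have "\<dots> = fact (Suc n) * fps_nth (R (Suc n)) j"
      unfolding step[symmetric] by (simp add: algebra_simps)
    finally show ?thesis unfolding Suc.hyps(2)[symmetric] R_def .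
  qed
qed

text \<open>The generalised geometric series for \<open>(1 - u Q)\<^sup>-\<^sup>a f\<close>; truncated subtraction is
  harmless: \<open>a = d = 0\<close> gives \<open>1\<close> and \<open>a = 0 < d\<close> gives \<open>0\<close>.\<close>

lemma inv_log_ser_power_mult_nth:
  "fps_nth (inv_log_ser ^ a * f) m
     = (\<Sum>d\<le>m. of_nat (a + d - 1 choose d) * fps_nth (log_tail ^ d * f) (m - d))"
proof (induction m arbitrary: a f)
  case 0
  show ?case by (simp add: inv_log_ser_def log_ser_def fps_nth_power_0)
next
  case (Suc m)
  \<comment> \<open>The outer induction lowers the coefficient index for all \<open>a\<close> and
    \<open>f\<close>; the inner one lowers the exponent.\<close>
  note IH_m = Suc.IH
  show ?case
  proof (induction a)
    case 0
    have "(\<Sum>d\<le>Suc m. of_nat (d - 1 choose d) * fps_nth (log_tail ^ d * f) (Suc m - d))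
        = fps_nth f (Suc m)"
      by (subst sum.atMost_Suc_shift) (simp add: binomial_eq_0)
    then show ?case by simp
  next
    case (Suc a)
    define q where "q = (\<lambda>d. fps_nth (log_tail ^ d * f) (Suc m - d))"
    have "inv_log_ser ^ Suc a * f
        = inv_log_ser ^ a * f + fps_X * (inv_log_ser ^ Suc a * (log_tail * f))"
    proof -
      have "inv_log_ser ^ Suc a * f
          = inv_log_ser ^ a * (1 + fps_X * (inv_log_ser * log_tail)) * f"
        using inv_log_ser_eq by (simp add: mult.commute mult.left_commute)
      then show ?thesis by (simp add: algebra_simps)
    qed
    then have "fps_nth (inv_log_ser ^ Suc a * f) (Suc m)
        = fps_nth (inv_log_ser ^ a * f) (Suc m)
          + fps_nth (inv_log_ser ^ Suc a * (log_tail * f)) m" by simp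
    also have "\<dots> = (\<Sum>d\<le>Suc m. of_nat (a + d - 1 choose d) * q d)
        + (\<Sum>d\<le>m. of_nat (a + d choose d) * q (Suc d))"
      unfolding Suc.IH IH_m q_def by (simp add: mult_ac power_commutes)
    also have "\<dots> = q 0 + (\<Sum>d\<le>m. of_nat ((a + d choose Suc d) + (a + d choose d)) * q (Suc d))"
      by (subst sum.atMost_Suc_shift) (simp add: sum.distrib algebra_simps)
    \<comment> \<open>Pascal's rule merges the two binomials.\<close>
    also have "\<dots> = (\<Sum>d\<le>Suc m. of_nat (Suc a + d - 1 choose d) * q d)"
      by (subst sum.atMost_Suc_shift) (simp add: add.commute)
    finally show ?case unfolding q_def .
  qed
qed


section \<open>2-adic estimates for the coefficients\<close>

lemma half_slope_geo_ser: "half_slope geo_ser"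
  unfolding half_slope_def
proof
  fix r
  have "(2::int) ^ r dvd (-2) ^ r"
    using power_minus[of "2::int" r] by (metis dvd_triv_right)
  then have "dvd2 r (of_int ((-2) ^ r))" by (rule dvd2_of_int)
  then have "dvd2 r (fps_nth geo_ser r)" by (simp add: geo_ser_def)
  then show "dvd2 ((r + 1) div 2) (fps_nth geo_ser r)" by (rule dvd2_mono) auto
qed

text \<open>The numerator supplies \<open>r + 1\<close> factors of 2, of which the denominator
  cancels \<open>nu2 (r + 2)\<close>. This is at most half of \<open>r + 2\<close>, because a power
  of 2 dividing \<open>r + 2\<close> cannot exceed it.\<close>

lemma half_slope_log_tail: "half_slope log_tail"
  unfolding half_slope_def
proof
  fix r :: nat
  define x where "x = nu2 (r + 2)"
  obtain B where B: "r + 2 = 2 ^ x * (2 * B + 1)" using nu2_decomp[of "r + 2"] x_def by auto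
  have x: "x \<le> (r + 2) div 2"
  proof (rule ccontr)
    assume "\<not> x \<le> (r + 2) div 2"
    then have "(2::nat) ^ Suc ((r + 2) div 2) \<le> 2 ^ x" by (intro power_increasing) auto
    also have "(2::nat) ^ x \<le> r + 2" using B by simp
    finally show False using less_exp[of "(r + 2) div 2"] by simp
  qed
  define e where "e = r + 1 - x"
  have e: "Suc r = e + x" "(r + 1) div 2 \<le> e" using x by (auto simp: e_def)
  have *: "(2::rat) + of_nat r = 2 ^ x * of_int (2 * int B + 1)"
    using arg_cong[OF B, of "of_nat :: nat \<Rightarrow> rat"] by (simp add: algebra_simps)
  have "fps_nth log_tail r * of_int (2 * int B + 1) = 2 ^ e * of_int (- ((-1) ^ Suc r))"
  proof -
    define C :: rat where "C = of_int (2 * int B + 1)"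
    have "C \<noteq> 0" unfolding C_def of_int_eq_0_iff by presburger
    have "(2::rat) ^ Suc r = 2 ^ e * 2 ^ x" unfolding e(1) by (rule power_add)
    then have "(-2::rat) ^ Suc r = (-1) ^ Suc r * (2 ^ e * 2 ^ x)"
      using power_minus[of "2::rat" "Suc r"] by (simp only:)
    moreover have "rat_of_nat (r + 2) = 2 ^ x * C" using * C_def by (simp add: add.commute)
    ultimately have "fps_nth log_tail r = - ((-1) ^ Suc r * (2 ^ e * 2 ^ x) / (2 ^ x * C))"
      by (simp only: log_tail_def fps_nth_Abs_fps)
    then have "fps_nth log_tail r * C = 2 ^ e * - ((-1) ^ Suc r)"
      using \<open>C \<noteq> 0\<close> by simp
    then show ?thesis by (simp add: C_def)
  qed
  moreover have "odd (2 * int B + 1)" by simp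
  ultimately have "dvd2 e (fps_nth log_tail r)" unfolding dvd2_def by blast
  with e(2) show "dvd2 ((r + 1) div 2) (fps_nth log_tail r)" by (metis dvd2_mono)
qed

text \<open>In the expansion, the term at \<open>d = m\<close> is the binomial itself, since
  \<open>log_tail\<close> and \<open>f\<close> have constant term 1. For
  \<open>m - d \<le> 2 * b\<close> the binomial supplies \<open>2 ^ b\<close> and the slope at least
  one more factor 2; for larger \<open>m - d\<close> the slope alone suffices.\<close>

lemma inv_log_ser_power_mult_nth_approx:
  assumes f: "half_slope f" "fps_nth f 0 = 1"
    and dvd: "\<And>d. d < m \<Longrightarrow> m - d \<le> 2 * b \<Longrightarrow> 2 ^ b dvd (n + d choose d)"
  shows "dvd2 (Suc b) (fps_nth (inv_log_ser ^ Suc n * f) m - of_nat (n + m choose m))"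
proof -
  define t where "t = (\<lambda>d. of_nat (n + d choose d) * fps_nth (log_tail ^ d * f) (m - d))"
  have "fps_nth (inv_log_ser ^ Suc n * f) m = sum t {..<Suc m}"
    unfolding inv_log_ser_power_mult_nth lessThan_Suc_atMost t_def by simp
  also have "\<dots> = sum t {..<m} + of_nat (n + m choose m)"
    using f(2) by (simp add: t_def fps_nth_power_0 log_tail_def)
  finally have "fps_nth (inv_log_ser ^ Suc n * f) m - of_nat (n + m choose m) = sum t {..<m}"
    by simp
  moreover have "dvd2 (Suc b) (t d)" if "d < m" for d
  proof -
    have slope: "dvd2 ((m - d + 1) div 2) (fps_nth (log_tail ^ d * f) (m - d))"
      using half_slope_power_mult[OF half_slope_log_tail f(1)] unfolding half_slope_def by blast
    show ?thesis
    proof (cases "m - d \<le> 2 * b")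
      case True
      have "dvd2 (b + (m - d + 1) div 2) (t d)"
        unfolding t_def using dvd[OF that True] slope by (intro dvd2_mult dvd2_of_nat)
      then show ?thesis using that by (elim dvd2_mono) auto
    next
      case False
      have "dvd2 (0 + (m - d + 1) div 2) (t d)"
        unfolding t_def using slope by (intro dvd2_mult dvd2_of_nat) auto
      then show ?thesis using False by (elim dvd2_mono) auto
    qed
  qed
  ultimately show ?thesis by (auto intro: dvd2_sum)
qed

text \<open>Agreement modulo one more power of 2 than \<open>c\<close> contains fixes the valuation;
  clearing an odd denominator moves the equation to the integers.\<close>

lemma nu2_eq_of_approx:
  assumes eq: "of_nat X = of_nat Y * q" and Y: "Y > 0" and c: "c > 0"
    and approx: "dvd2 (Suc (nu2 c)) (q - of_nat c)"
  shows "nu2 X = nu2 Y + nu2 c"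
proof -
  obtain a w where w: "odd w" "(q - of_nat c) * of_int w = 2 ^ Suc (nu2 c) * of_int a"
    using approx dvd2_def by auto
  obtain B where B: "c = 2 ^ nu2 c * (2 * B + 1)" using nu2_decomp[OF c] by auto
  \<comment> \<open>With \<open>2 ^ nu2 c\<close> factored out of \<open>q * of_int w\<close>, the
    error contributes only the even number \<open>2 * a\<close>.\<close>
  define z where "z = (2 * int B + 1) * w + 2 * a"
  have z: "odd z" using w by (simp add: z_def)
  have "rat_of_nat c = 2 ^ nu2 c * of_int (2 * int B + 1)"
    by (subst B) (simp add: algebra_simps)
  then have "q * of_int w = 2 ^ nu2 c * of_int z"
    using w(2) by (simp add: z_def algebra_simps)
  then have "of_nat X * of_int w = of_nat Y * (2 ^ nu2 c * rat_of_int z)"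
    using eq by (simp add: mult.assoc)
  then have "rat_of_int (int X * w) = rat_of_int (int Y * (2 ^ nu2 c * z))" by simp
  then have "int X * w = int Y * (2 ^ nu2 c * z)" by (simp only: of_int_eq_iff)
  then have "nat \<bar>int X * w\<bar> = nat \<bar>int Y * (2 ^ nu2 c * z)\<bar>" by simp
  then have XY: "X * nat \<bar>w\<bar> = Y * (2 ^ nu2 c * nat \<bar>z\<bar>)"
    by (simp add: abs_mult nat_mult_distrib nat_power_eq)
  have odd: "nu2 (nat \<bar>v\<bar>) = 0" "nat \<bar>v\<bar> > 0" if "odd v" for v :: int
    using that by (auto intro: not_dvd_imp_multiplicity_0 simp: even_nat_iff)
  have "X > 0" using XY Y odd(2)[OF z] by (cases "X = 0") auto
  then have "nu2 X = nu2 (X * nat \<bar>w\<bar>)" using odd[OF w(1)] by (simp add: nu2_mult)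
  also have "\<dots> = nu2 Y + nu2 c"
    unfolding XY using Y odd[OF z] by (simp add: nu2_mult)
  finally show ?thesis .
qed

section \<open>Valuations of Stirling numbers from the two coefficient formulas\<close>

lemma Stirling_pos:
  assumes "k > 0"
  shows "Stirling (k + m) k > 0"
proof (induction m)
  case (Suc m)
  then show ?case using assms by (cases k) auto
qed simp

text \<open>This is the formula with exponent -n-1. Legendre's formula turns the factorials into
  digit sums, and the remaining \<open>n\<close>, \<open>k\<close> and \<open>m\<close>
  cancel.\<close>

lemma nu2_Stirling_upper:
  assumes k: "k > 0" and n: "n = k + m"
    and dvd: "\<And>d. d < m \<Longrightarrow> m - d \<le> 2 * nu2 (n + m choose m)
      \<Longrightarrow> nu2 (n + m choose m) \<le> nu2 (n + d choose d)"
  shows "nu2 (Stirling n k) + binary_digit_sum n = binary_digit_sum k + nu2 (n + m choose m)"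
proof -
  have "nu2 (Stirling n k * fact k * 2 ^ m) = nu2 (fact n) + nu2 (n + m choose m)"
  proof (rule nu2_eq_of_approx)
    show "rat_of_nat (Stirling n k * fact k * 2 ^ m)
        = of_nat (fact n) * fps_nth (inv_log_ser ^ Suc n * geo_ser) m"
      using Stirling_eq_nth[of k m] by (simp add: n)
    show "dvd2 (Suc (nu2 (n + m choose m)))
        (fps_nth (inv_log_ser ^ Suc n * geo_ser) m - of_nat (n + m choose m))"
      by (intro inv_log_ser_power_mult_nth_approx half_slope_geo_ser multiplicity_dvd' dvd)
        (simp_all add: geo_ser_def)
  qed auto
  moreover have "nu2 (Stirling n k * fact k * 2 ^ m) = nu2 (Stirling n k) + nu2 (fact k) + m"
    using Stirling_pos[OF k, of m] by (simp add: n nu2_mult)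
  ultimately show ?thesis using legendre_2[of n] legendre_2[of k] n by linarith
qed

text \<open>This is the formula (k/n) [u^m] G^(-n), with \<open>Suc n\<close> in the role of n
  there.\<close>

lemma nu2_Stirling_lower:
  assumes k: "k > 0" and n: "Suc n = k + m"
    and dvd: "\<And>d. d < m \<Longrightarrow> m - d \<le> 2 * nu2 (n + m choose m)
      \<Longrightarrow> nu2 (n + m choose m) \<le> nu2 (n + d choose d)"
  shows "nu2 (Stirling (Suc n) k) + binary_digit_sum n
    = binary_digit_sum (k - 1) + nu2 (n + m choose m)"
proof -
  let ?S = "Stirling (Suc n) k"
  \<comment> \<open>The extra factors \<open>Suc n\<close> and \<open>k\<close> clear the fraction
    k/n.\<close>
  have "nu2 (?S * fact k * 2 ^ m * Suc n) = nu2 (fact (Suc n) * k) + nu2 (n + m choose m)"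
  proof (rule nu2_eq_of_approx)
    have "rat_of_nat (?S * fact k * 2 ^ m * Suc n) = rat_of_nat ?S * fact k * 2 ^ m * of_nat (Suc n)"
      by (simp only: of_nat_mult of_nat_power of_nat_fact of_nat_numeral)
    also have "\<dots> = fact (Suc n) *
        (of_nat (Suc n) * fps_nth (inv_log_ser ^ Suc (Suc n) * geo_ser) m)"
      using Stirling_eq_nth[of k m] unfolding n[symmetric] by (simp only: mult_ac)
    also have "\<dots> = fact (Suc n) * (of_nat k * fps_nth (inv_log_ser ^ Suc n * 1) m)"
      using inv_log_ser_power_nth[of k m] unfolding n[symmetric] by (simp only: mult_1_right)
    finally show "rat_of_nat (?S * fact k * 2 ^ m * Suc n)
        = of_nat (fact (Suc n) * k) * fps_nth (inv_log_ser ^ Suc n * 1) m"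
      by (simp only: of_nat_mult of_nat_fact mult.assoc)
    show "dvd2 (Suc (nu2 (n + m choose m)))
        (fps_nth (inv_log_ser ^ Suc n * 1) m - of_nat (n + m choose m))"
      by (intro inv_log_ser_power_mult_nth_approx half_slope_1 multiplicity_dvd' dvd) simp_all
  qed (use k in auto)
  moreover have "nu2 (?S * fact k * 2 ^ m * Suc n) = nu2 ?S + nu2 (fact k) + m + nu2 (Suc n)"
  proof -
    have S: "?S > 0" using Stirling_pos[OF k, of m] unfolding n .
    then have "nu2 (?S * fact k * 2 ^ m * Suc n) = nu2 (?S * fact k * 2 ^ m) + nu2 (Suc n)"
      by (intro nu2_mult) (simp_all del: Stirling.simps)
    also have "nu2 (?S * fact k * 2 ^ m) = nu2 (?S * fact k) + nu2 (2 ^ m)"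
      using S by (intro nu2_mult) (simp_all del: Stirling.simps)
    also have "nu2 (?S * fact k) = nu2 ?S + nu2 (fact k)"
      using S by (intro nu2_mult) (simp_all del: Stirling.simps)
    also have "nu2 (2 ^ m) = m" by simp
    finally show ?thesis .
  qed
  moreover have "nu2 (fact (Suc n) * k) = nu2 (fact (Suc n)) + nu2 k"
    using k by (intro nu2_mult) auto
  \<comment> \<open>This and its analogue for \<open>Suc n\<close> absorb the valuations of the two
    extra factors.\<close>
  moreover have "binary_digit_sum k + nu2 k = Suc (binary_digit_sum (k - 1))"
    using binary_digit_sum_Suc[of "k - 1"] k by simp
  ultimately show ?thesis
    using legendre_2[of "Suc n"] legendre_2[of k] binary_digit_sum_Suc[of n] n by linarith
qed

section \<open>Scaling by powers of 2 and the digit conditions\<close>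

lemma mem_binary_powers_iff: "2 ^ i \<in> binary_powers m \<longleftrightarrow> m div 2 ^ i mod 2 = 1"
  by (auto simp: binary_powers_def)

lemma digit_mult_pow2: "(2 ^ h * n) div 2 ^ (h + x) mod 2 = n div 2 ^ x mod (2::nat)"
  by (simp add: power_add)

lemma digit_below_nu2:
  assumes "x < nu2 n"
  shows "n div 2 ^ x mod 2 = 0"
proof -
  have "2 ^ Suc x dvd n" using assms by (intro multiplicity_dvd') auto
  then obtain c where "n = 2 ^ x * (2 * c)" by (auto simp: mult_ac)
  then show ?thesis by simp
qed

lemma nu2_add_eq_min:
  assumes "a > 0" "b > 0" "nu2 a < nu2 b"
  shows "nu2 (a + b) = nu2 a"
  using multiplicity_sum_lt[of 2 a b] assms by (simp add: add.commute)

lemma nu2_binomial_mult_pow2: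
  "nu2 (2 ^ h * n + 2 ^ h * m choose (2 ^ h * m)) = nu2 (n + m choose m)"
  using nu2_binomial[of "2 ^ h * n" "2 ^ h * m"] nu2_binomial[of n m]
  by (simp add: binary_digit_sum_pow2_mult flip: distrib_left)

text \<open>Valuations of the two sides of
  \<open>(n + m) * (n - 1 + m choose m) = n * (n + m choose m)\<close>.\<close>

lemma nu2_binomial_pred:
  assumes "n > 0"
  shows "nu2 (n - 1 + m choose m) + nu2 (n + m) = nu2 n + nu2 (n + m choose m)"
  using nu2_binomial[of "n - 1" m] nu2_binomial[of n m] assms
    binary_digit_sum_Suc[of "n - 1"] binary_digit_sum_Suc[of "n - 1 + m"] by simp

text \<open>The upper index is not simply shifted here. Via \<open>nu2_binomial_pred\<close> the
  claim reduces to \<open>nu2_binomial_mult_pow2\<close>, with \<open>h\<close> cancelling between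
  the valuations of \<open>n\<close> and \<open>n + m\<close>.\<close>

lemma nu2_binomial_pred_mult_pow2:
  assumes "n > 0"
  shows "nu2 (2 ^ h * n - 1 + 2 ^ h * m choose (2 ^ h * m)) = nu2 (n - 1 + m choose m)"
  using nu2_binomial_pred[of n m] nu2_binomial_pred[of "2 ^ h * n" "2 ^ h * m"] assms
    nu2_binomial_mult_pow2[of h n m] nu2_pow2_mult[of n h] nu2_pow2_mult[of "n + m" h]
  by (simp add: distrib_left)

text \<open>The valuation of the binomial does not depend on \<open>h\<close>, while the carry
  comparison covers a window of length \<open>2 ^ (h + nu2 m)\<close>. Assumption \<open>h\<close>
  makes this window contain every \<open>d\<close> for which the slope alone is too weak.\<close>

lemma nu2_Stirling_scaled_upper:
  assumes k: "k > 0" and m: "m > 0" and n: "n = k + m"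
    and bit: "n div 2 ^ nu2 m mod 2 = 0"
    and h: "2 * nu2 (n + m choose m) \<le> 2 ^ (h + nu2 m)"
  shows "nu2 (Stirling (2 ^ h * n) (2 ^ h * k)) + binary_digit_sum n
    = binary_digit_sum k + nu2 (n + m choose m)"
proof -
  have "nu2 (Stirling (2 ^ h * n) (2 ^ h * k)) + binary_digit_sum (2 ^ h * n)
    = binary_digit_sum (2 ^ h * k) + nu2 (2 ^ h * n + 2 ^ h * m choose (2 ^ h * m))"
  proof (rule nu2_Stirling_upper)
    fix d
    assume "d < 2 ^ h * m" "2 ^ h * m - d \<le> 2 * nu2 (2 ^ h * n + 2 ^ h * m choose (2 ^ h * m))"
    then show "nu2 (2 ^ h * n + 2 ^ h * m choose (2 ^ h * m)) \<le> nu2 (2 ^ h * n + d choose d)"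
      using h m bit
      by (intro nu2_binomial_le_digit_0)
        (auto simp: nu2_binomial_mult_pow2 nu2_pow2_mult digit_mult_pow2)
  qed (use k n in \<open>auto simp: algebra_simps\<close>)
  then show ?thesis by (simp add: binary_digit_sum_pow2_mult nu2_binomial_mult_pow2)
qed

text \<open>Subtracting 1 clears the lowest one of \<open>n\<close>, at position
  \<open>nu2 n = nu2 m\<close>, so the comparison for digit 0 applies to
  \<open>n - 1\<close>.\<close>

lemma nu2_binomial_pred_le_eq:
  assumes n: "n > 0" and m: "m > 0" and nu: "nu2 m = nu2 n"
    and d: "d < m" "m - d \<le> 2 ^ nu2 n"
  shows "nu2 (n - 1 + m choose m) \<le> nu2 (n - 1 + d choose d)"
proof (rule nu2_binomial_le_digit_0)
  obtain B where B: "n = 2 ^ nu2 n * (2 * B + 1)" using nu2_decomp[OF n] .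
  have "n - 1 = 2 ^ nu2 n * (2 * B) + (2 ^ nu2 n - 1)" by (subst B) (simp add: algebra_simps)
  then have "(n - 1) div 2 ^ nu2 n = (2 ^ nu2 n * (2 * B) + (2 ^ nu2 n - 1)) div 2 ^ nu2 n"
    by (rule arg_cong)
  also have "\<dots> = 2 * B" by (subst div_mult_self4) auto
  finally have "(n - 1) div 2 ^ nu2 n = 2 * B" .
  then show "(n - 1) div 2 ^ nu2 m mod 2 = 0" by (simp add: nu)
qed (use assms in auto)

text \<open>The borrow in \<open>n - 1\<close> stays below position \<open>nu2 m\<close>, so the
  digit there remains 1. The low part \<open>s\<close> of \<open>n\<close> is a positive multiple of
  \<open>2 ^ nu2 n\<close>, which only guarantees \<open>s - 1 \<ge> 2 ^ nu2 n - 1\<close>; hence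
  the strict bound on \<open>m - d\<close>.\<close>

lemma nu2_binomial_pred_le_less:
  assumes n: "n > 0" and m: "m > 0" and nu: "nu2 n < nu2 m"
    and bit: "n div 2 ^ nu2 m mod 2 = 1"
    and d: "d < m" "m - d < 2 ^ nu2 n"
  shows "nu2 (n - 1 + m choose m) \<le> nu2 (n - 1 + d choose d)"
proof (rule nu2_binomial_le_digit_1)
  define x s where "x = nu2 m" and "s = n mod 2 ^ x"
  have "\<not> 2 ^ x dvd n"
    using nu n by (simp add: x_def power_dvd_iff_le_multiplicity)
  then have s: "s > 0" unfolding s_def by (simp add: mod_greater_zero_iff_not_dvd)
  have "2 ^ nu2 n dvd s"
    unfolding s_def x_def using nu by (intro dvd_mod multiplicity_dvd le_imp_power_dvd) auto
  with s have le: "2 ^ nu2 n \<le> s" by (simp add: dvd_imp_le)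
  have "s < 2 ^ x" by (simp add: s_def)
  have eq: "n - 1 = 2 ^ x * (n div 2 ^ x) + (s - 1)"
    using s div_mult_mod_eq[of n "2 ^ x"] unfolding s_def by (simp add: mult.commute)
  have "(n - 1) div 2 ^ x = n div 2 ^ x + (s - 1) div 2 ^ x"
    by (subst eq, rule div_mult_self4) simp
  moreover have "(n - 1) mod 2 ^ x = (s - 1) mod 2 ^ x"
    by (subst eq, rule mod_mult_self4)
  ultimately have "(n - 1) div 2 ^ x = n div 2 ^ x" "(n - 1) mod 2 ^ x = s - 1"
    using \<open>s < 2 ^ x\<close> by simp_all
  then show "(n - 1) div 2 ^ nu2 m mod 2 = 1" "m - d \<le> (n - 1) mod 2 ^ nu2 m"
    using bit le d unfolding x_def by auto
qed (use assms in auto)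

lemma nu2_Stirling_scaled_lower:
  assumes k: "k > 0" and m: "m > 0" and n: "n = k + m"
    and cases: "nu2 m = nu2 n \<and> 2 * nu2 (n - 1 + m choose m) \<le> 2 ^ (h + nu2 n) \<or>
      nu2 n < nu2 m \<and> n div 2 ^ nu2 m mod 2 = 1 \<and>
      2 * nu2 (n - 1 + m choose m) < 2 ^ (h + nu2 n)"
  shows "nu2 (Stirling (2 ^ h * n) (2 ^ h * k)) + binary_digit_sum (n - 1)
    = binary_digit_sum (k - 1) + nu2 (n - 1 + m choose m)"
proof -
  have n0: "n > 0" using n m by simp
  have "nu2 (Stirling (Suc (2 ^ h * n - 1)) (2 ^ h * k)) + binary_digit_sum (2 ^ h * n - 1)
    = binary_digit_sum (2 ^ h * k - 1) + nu2 (2 ^ h * n - 1 + 2 ^ h * m choose (2 ^ h * m))"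
  proof (rule nu2_Stirling_lower)
    fix d
    assume d: "d < 2 ^ h * m"
      "2 ^ h * m - d \<le> 2 * nu2 (2 ^ h * n - 1 + 2 ^ h * m choose (2 ^ h * m))"
    note binom = nu2_binomial_pred_mult_pow2[OF n0, of h m]
    from cases show "nu2 (2 ^ h * n - 1 + 2 ^ h * m choose (2 ^ h * m))
        \<le> nu2 (2 ^ h * n - 1 + d choose d)"
    proof
      assume "nu2 m = nu2 n \<and> 2 * nu2 (n - 1 + m choose m) \<le> 2 ^ (h + nu2 n)"
      with d n0 m show ?thesis
        by (intro nu2_binomial_pred_le_eq)
          (auto simp only: binom nu2_pow2_mult nat_0_less_mult_iff zero_less_power zero_less_numeral)
    next
      assume "nu2 n < nu2 m \<and> n div 2 ^ nu2 m mod 2 = 1 \<and>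
        2 * nu2 (n - 1 + m choose m) < 2 ^ (h + nu2 n)"
      with d n0 m show ?thesis
        by (intro nu2_binomial_pred_le_less)
          (auto simp only: binom nu2_pow2_mult digit_mult_pow2 nat_0_less_mult_iff zero_less_power
            zero_less_numeral add_less_cancel_left)
    qed
  qed (use k n in \<open>auto simp: algebra_simps\<close>)
  \<comment> \<open>In binary, \<open>2 ^ h * v - 1\<close> is \<open>v - 1\<close> followed by
    \<open>h\<close> ones; the added \<open>h\<close> occurs for \<open>k\<close> and
    \<open>n\<close> alike and cancels.\<close>
  moreover have "binary_digit_sum (2 ^ h * v - 1) + 1 = binary_digit_sum (v - 1) + 1 + h"
    if "v > 0" for v
    using binary_digit_sum_Suc[of "2 ^ h * v - 1"] binary_digit_sum_Suc[of "v - 1"] that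
    by (simp add: binary_digit_sum_pow2_mult nu2_pow2_mult)
  from this[OF k] this[OF n0] have
    "binary_digit_sum (2 ^ h * k - 1) = binary_digit_sum (k - 1) + h"
    "binary_digit_sum (2 ^ h * n - 1) = binary_digit_sum (n - 1) + h" by simp_all
  ultimately show ?thesis using n0 nu2_binomial_pred_mult_pow2[OF n0, of h m] by simp
qed

section \<open>Thresholds, limits and the final case distinction\<close>

text \<open>The exponent is -1 at \<open>h = x = 0\<close>, hence \<open>powi\<close>; doubling
  moves the comparison to the naturals.\<close>

lemma powi_ge_iff: "(2::real) powi (int h - 1 + int x) \<ge> real b \<longleftrightarrow> 2 * b \<le> 2 ^ (h + x)"
  and powi_greater_iff: "(2::real) powi (int h - 1 + int x) > real b \<longleftrightarrow> 2 * b < 2 ^ (h + x)"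
proof -
  have "(2::real) powi (int (h + x) - 1) = real (2 ^ (h + x)) / 2"
    by (subst power_int_diff) (simp_all del: of_nat_add)
  moreover have "int h - 1 + int x = int (h + x) - 1" by simp
  ultimately have eq: "(2::real) powi (int h - 1 + int x) = real (2 ^ (h + x)) / 2" by metis
  have "real b \<le> real (2 ^ (h + x)) / 2 \<longleftrightarrow> real (2 * b) \<le> real (2 ^ (h + x))"
    "real b < real (2 ^ (h + x)) / 2 \<longleftrightarrow> real (2 * b) < real (2 ^ (h + x))" by auto
  then show "(2::real) powi (int h - 1 + int x) \<ge> real b \<longleftrightarrow> 2 * b \<le> 2 ^ (h + x)"
    "(2::real) powi (int h - 1 + int x) > real b \<longleftrightarrow> 2 * b < 2 ^ (h + x)"
    unfolding eq of_nat_le_iff of_nat_less_iff by auto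
qed

lemma tendsto_of_eventual_value:
  fixes b x :: nat and f :: "nat \<Rightarrow> real"
  assumes "\<And>h. 2 * b < 2 ^ (h + x) \<Longrightarrow> f h = L"
  shows "f \<longlonglongrightarrow> L"
proof (rule tendsto_eventually, rule eventually_sequentiallyI)
  fix h
  assume "2 * b \<le> h"
  then have "2 * b < 2 ^ (h + x)"
    using less_exp[of "h + x"] by linarith
  then show "f h = L" by (rule assms)
qed

theorem theorem2p6:
  fixes n k :: nat
  assumes "1 \<le> k" and "k < n"
  shows
    "(nu2 k < nu2 n \<or> (nu2 k = nu2 n \<and> 2 ^ nu2 (n - k) \<in> binary_powers k) \<longrightarrow>
       (let L = real (binary_digit_sum k) - real (binary_digit_sum n)
                  + real (nu2 ((n + n - k) choose n))
        in ((\<lambda>h. real (nu2 (Stirling (2 ^ h * n) (2 ^ h * k)))) \<longlonglongrightarrow> L) \<and>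
           (\<forall>h::nat. (2::real) powi (int h - 1 + int (nu2 (n - k)))
                         \<ge> real (nu2 ((n + n - k) choose n)) \<longrightarrow>
              real (nu2 (Stirling (2 ^ h * n) (2 ^ h * k))) = L)))
     \<and>
     (nu2 n < nu2 k \<or> (nu2 n = nu2 k \<and> 2 ^ nu2 (n - k) \<in> binary_powers n) \<longrightarrow>
       (let L = real (binary_digit_sum (k - 1)) - real (binary_digit_sum (n - 1))
                  + real (nu2 ((n - 1 + n - k) choose (n - 1)))
        in ((\<lambda>h. real (nu2 (Stirling (2 ^ h * n) (2 ^ h * k)))) \<longlonglongrightarrow> L) \<and>
           (nu2 n < nu2 k \<longrightarrow>
              (\<forall>h::nat. (2::real) powi (int h - 1 + int (nu2 n))
                            \<ge> real (nu2 ((n - 1 + n - k) choose (n - 1))) \<longrightarrow>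
                 real (nu2 (Stirling (2 ^ h * n) (2 ^ h * k))) = L)) \<and>
           (nu2 n = nu2 k \<and> 2 ^ nu2 (n - k) \<in> binary_powers n \<longrightarrow>
              (\<forall>h::nat. (2::real) powi (int h - 1 + int (nu2 n))
                            > real (nu2 ((n - 1 + n - k) choose (n - 1))) \<longrightarrow>
                 real (nu2 (Stirling (2 ^ h * n) (2 ^ h * k))) = L))))"
proof (intro conjI impI)
  define m where "m = n - k"
  have k: "k > 0" and m: "m > 0" and n: "n = k + m" and nk: "n - k = m"
    using assms by (auto simp: m_def)
  have n0: "n > 0" using assms by simp
  {
    assume hyp: "nu2 k < nu2 n \<or> (nu2 k = nu2 n \<and> 2 ^ nu2 (n - k) \<in> binary_powers k)"
    define b where "b = nu2 (n + m choose m)"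
    have ch: "nu2 ((n + n - k) choose n) = b"
      unfolding b_def using binomial_symmetric[of m "n + m"] n by (simp add: add.commute)
    have bit: "n div 2 ^ nu2 m mod 2 = 0"
      using hyp
    proof
      assume "nu2 k < nu2 n"
      \<comment> \<open>If they differed, the valuation of \<open>n = k + m\<close> would be the
        smaller one, hence at most \<open>nu2 k\<close>.\<close>
      moreover have "nu2 m = nu2 k"
      proof (rule ccontr)
        assume "nu2 m \<noteq> nu2 k"
        then consider "nu2 m < nu2 k" | "nu2 k < nu2 m" by linarith
        then show False
          using nu2_add_eq_min[of m k] nu2_add_eq_min[of k m] k m n \<open>nu2 k < nu2 n\<close>
          by cases (auto simp: add.commute)
      qed
      ultimately show ?thesis by (simp add: digit_below_nu2)
    next
      assume "nu2 k = nu2 n \<and> 2 ^ nu2 (n - k) \<in> binary_powers k"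
      then have "k div 2 ^ nu2 m mod 2 = 1" by (simp add: nk mem_binary_powers_iff)
      moreover obtain B where B: "m = 2 ^ nu2 m * (2 * B + 1)" using nu2_decomp[OF m] .
      \<comment> \<open>As \<open>m\<close> is zero below position \<open>nu2 m\<close>, no carry
        arrives there, and the ones of \<open>k\<close> and \<open>m\<close> add to digit 0.\<close>
      have "n div 2 ^ nu2 m = k div 2 ^ nu2 m + (2 * B + 1)"
      proof -
        have "n = 2 ^ nu2 m * (2 * B + 1) + k" using B n by simp
        then have "n div 2 ^ nu2 m = (2 ^ nu2 m * (2 * B + 1) + k) div 2 ^ nu2 m"
          by (rule arg_cong)
        also have "\<dots> = (2 * B + 1) + k div 2 ^ nu2 m" by (rule div_mult_self4) simp
        finally show ?thesis by simp
      qed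
      ultimately show ?thesis
        using mod_add_eq[of "k div 2 ^ nu2 m" 2 "2 * B + 1"] by simp
    qed
    have val: "real (nu2 (Stirling (2 ^ h * n) (2 ^ h * k)))
        = real (binary_digit_sum k) - real (binary_digit_sum n) + real b"
      if "2 * b \<le> 2 ^ (h + nu2 m)" for h
    proof -
      have "real (nu2 (Stirling (2 ^ h * n) (2 ^ h * k)) + binary_digit_sum n)
          = real (binary_digit_sum k + b)"
        using nu2_Stirling_scaled_upper[OF k m n bit that[unfolded b_def]] unfolding b_def
        by (rule arg_cong)
      then show ?thesis by simp
    qed
    show "let L = real (binary_digit_sum k) - real (binary_digit_sum n)
                  + real (nu2 ((n + n - k) choose n))
        in ((\<lambda>h. real (nu2 (Stirling (2 ^ h * n) (2 ^ h * k)))) \<longlonglongrightarrow> L) \<and>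
           (\<forall>h::nat. (2::real) powi (int h - 1 + int (nu2 (n - k)))
                         \<ge> real (nu2 ((n + n - k) choose n)) \<longrightarrow>
              real (nu2 (Stirling (2 ^ h * n) (2 ^ h * k))) = L)"
      unfolding Let_def ch powi_ge_iff nk
      using val by (auto intro: tendsto_of_eventual_value[of b "nu2 m"])
  }
  {
    assume hyp: "nu2 n < nu2 k \<or> (nu2 n = nu2 k \<and> 2 ^ nu2 (n - k) \<in> binary_powers n)"
    define b where "b = nu2 (n - 1 + m choose m)"
    define L where "L = real (binary_digit_sum (k - 1)) - real (binary_digit_sum (n - 1)) + real b"
    have ch: "nu2 ((n - 1 + n - k) choose (n - 1)) = b"
    proof -
      have "n - 1 + n - k = n - 1 + m" using n n0 by simp
      moreover have "n - 1 + m choose (n - 1) = (n - 1 + m choose m)"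
        using binomial_symmetric[of m "n - 1 + m"] by simp
      ultimately show ?thesis unfolding b_def by (simp only:)
    qed
    have valI: "real (nu2 (Stirling (2 ^ h * n) (2 ^ h * k))) = L"
      if "nu2 m = nu2 n \<and> 2 * b \<le> 2 ^ (h + nu2 n) \<or>
        nu2 n < nu2 m \<and> n div 2 ^ nu2 m mod 2 = 1 \<and> 2 * b < 2 ^ (h + nu2 n)" for h
    proof -
      have "real (nu2 (Stirling (2 ^ h * n) (2 ^ h * k)) + binary_digit_sum (n - 1))
          = real (binary_digit_sum (k - 1) + b)"
        using nu2_Stirling_scaled_lower[OF k m n that[unfolded b_def]] unfolding b_def
        by (rule arg_cong)
      then show ?thesis unfolding L_def by simp
    qed
    have val1: "real (nu2 (Stirling (2 ^ h * n) (2 ^ h * k))) = L"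
      if "nu2 n < nu2 k" "2 * b \<le> 2 ^ (h + nu2 n)" for h
    proof -
      have "nu2 m = nu2 n"
      proof (rule ccontr)
        assume "nu2 m \<noteq> nu2 n"
        then consider "nu2 m < nu2 k" | "nu2 k < nu2 m" | "nu2 m = nu2 k" by linarith
        then show False
        proof cases
          \<comment> \<open>For equal valuations only the inequality
            \<open>nu2 k \<le> nu2 n\<close> is available, which is enough.\<close>
          case 3
          have "2 ^ nu2 k dvd k + m" using 3 by (metis dvd_add multiplicity_dvd)
          then have "nu2 k \<le> nu2 n"
            using n0 n by (intro multiplicity_geI) auto
          with that show False by simp
        qed (use nu2_add_eq_min[of m k] nu2_add_eq_min[of k m] k m n that \<open>nu2 m \<noteq> nu2 n\<close>
              in \<open>auto simp: add.commute\<close>)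
      qed
      then show ?thesis using that(2) by (intro valI) simp
    qed
    have val2: "real (nu2 (Stirling (2 ^ h * n) (2 ^ h * k))) = L"
      if "nu2 n = nu2 k \<and> 2 ^ nu2 (n - k) \<in> binary_powers n" "2 * b < 2 ^ (h + nu2 n)" for h
    proof -
      have bit: "n div 2 ^ nu2 m mod 2 = 1" using that by (simp add: nk mem_binary_powers_iff)
      have "2 ^ nu2 n dvd k + m" "2 ^ nu2 n dvd k"
        using multiplicity_dvd[of 2 n] multiplicity_dvd[of 2 k] that n by auto
      then have "2 ^ nu2 n dvd m" by (simp add: dvd_add_right_iff)
      then have "nu2 n \<le> nu2 m" using m by (intro multiplicity_geI) auto
      \<comment> \<open>Equality would make the quotients of \<open>k\<close> and \<open>m\<close>
        by \<open>2 ^ nu2 m\<close> both odd, hence that of \<open>n\<close> even, against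
        \<open>bit\<close>.\<close>
      moreover have "nu2 n \<noteq> nu2 m"
      proof
        assume "nu2 n = nu2 m"
        obtain A where A: "k = 2 ^ nu2 k * (2 * A + 1)" using nu2_decomp[OF k] .
        obtain B where B: "m = 2 ^ nu2 m * (2 * B + 1)" using nu2_decomp[OF m] .
        have "nu2 k = nu2 m" using that \<open>nu2 n = nu2 m\<close> by simp
        then have "n = 2 ^ nu2 m * (2 * A + 1) + 2 ^ nu2 m * (2 * B + 1)"
          using A B n by metis
        also have "\<dots> = 2 ^ nu2 m * (2 * (A + B + 1))" by (simp add: algebra_simps)
        finally have "n div 2 ^ nu2 m = 2 ^ nu2 m * (2 * (A + B + 1)) div 2 ^ nu2 m"
          by (rule arg_cong)
        also have "\<dots> = 2 * (A + B + 1)" by (rule nonzero_mult_div_cancel_left) simp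
        finally show False using bit by simp
      qed
      ultimately have "nu2 n < nu2 m" by simp
      then show ?thesis using that(2) bit by (intro valI) simp
    qed
    have "(\<lambda>h. real (nu2 (Stirling (2 ^ h * n) (2 ^ h * k)))) \<longlonglongrightarrow> L"
      \<comment> \<open>The strict threshold supplied by this rule serves both alternatives of
        \<open>hyp\<close>.\<close>
      by (rule tendsto_of_eventual_value[of b "nu2 n"]) (use hyp val1 val2 in force)
    then show "let L = real (binary_digit_sum (k - 1)) - real (binary_digit_sum (n - 1))
                  + real (nu2 ((n - 1 + n - k) choose (n - 1)))
        in ((\<lambda>h. real (nu2 (Stirling (2 ^ h * n) (2 ^ h * k)))) \<longlonglongrightarrow> L) \<and>
           (nu2 n < nu2 k \<longrightarrow>
              (\<forall>h::nat. (2::real) powi (int h - 1 + int (nu2 n))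
                            \<ge> real (nu2 ((n - 1 + n - k) choose (n - 1))) \<longrightarrow>
                 real (nu2 (Stirling (2 ^ h * n) (2 ^ h * k))) = L)) \<and>
           (nu2 n = nu2 k \<and> 2 ^ nu2 (n - k) \<in> binary_powers n \<longrightarrow>
              (\<forall>h::nat. (2::real) powi (int h - 1 + int (nu2 n))
                            > real (nu2 ((n - 1 + n - k) choose (n - 1))) \<longrightarrow>
                 real (nu2 (Stirling (2 ^ h * n) (2 ^ h * k))) = L))"
      unfolding Let_def ch powi_ge_iff powi_greater_iff L_def[symmetric]
      using val1 val2 by blast
  }
qed

end
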